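(* Consider the scalar stochastic differential equation $$dX_t=b(X_t)\,dt+\sigma_1(X_t)\,dW_t+\sigma_2\,d\tilde L_t^{\alpha},$$ where $b(x)=\sum_{i=0}^{p_1}\xi_i x^i$ and $\sigma_1(x)=\sum_{j=0}^{p_2}\eta_j x^j$ are real polynomials and $\sigma_2\ge 0$ is a constant. Let $\Psi(x)=[1,x,\ldots,x^{N_k}]$ be the polynomial basis with $N_k$ large enough (so that $N_k\ge\max\{2,\,p_1+1,\,2p_2\}$). Let $L\in\mathbb{R}^{(N_k+1)\times(N_k+1)}$ be the matrix representing (approximating) the generator in this basis, let $\xi=LB_1$ be the coefficient vector of $b$, and let $\rho=LB_2-2(\xi)_+=[\rho_0,\rho_1,\ldots,\rho_{N_k}]^\top$. Suppose that $\sigma_1$ is not a constant and that the system $$\begin{pmatrix}\tilde\eta_0\\ \tilde\eta_1\\ \vdots\\ \tilde\eta_{2p_2}\\ 0\\ \vdots\\ 0\end{pmatrix}+\begin{pmatrix}\tilde C\sigma_2^2\\ 0\\ \vdots\\ 0\\ 0\\ \vdots\\ 0\end{pmatrix}=\begin{pmatrix}\rho_0\\ \rho_1\\ \vdots\\ \rho_{2p_2}\\ 0\\ \vdots\\ 0\end{pmatrix},\qquad \tilde\eta_j=\sum_{\substack{k+l=j\\ 0\le k,l\le p_2}}\eta_k\eta_l ,$$ is well defined, i.e. $\rho_i=0$ for $i>2p_2$ and the system is satisfied by the coefficients $\eta_0,\ldots,\eta_{p_2}$ of $\sigma_1$ and by $\sigma_2$. Then $\sigma_1$ and $\sigma_2$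 can be separated: the polynomial $\sigma_1^2$ and the constant $\sigma_2\ge 0$ are uniquely determined by $\rho$. That is, if $(\eta_0,\ldots,\eta_{p_2},\sigma_2)$ and $(\eta_0',\ldots,\eta_{p_2}',\sigma_2')$, with all $\eta_j,\eta_j'\in\mathbb{R}$ and $\sigma_2,\sigma_2'\ge0$, both satisfy the system with the same $\rho$, and $\sigma_1(x)=\sum_j\eta_jx^j$ and $\sigma_1'(x)=\sum_j\eta_j'x^j$ are both non-constant, then $\sigma_1^2=(\sigma_1')^2$ as polynomials and $\sigma_2=\sigma_2'$.
   Context: $W_t$ is a scalar Brownian motion. $\tilde L_t^{\alpha}$ is a scalar symmetric Lévy motion with triple $(0,0,\tilde\nu)$, where $\tilde\nu(dx)=C_\alpha I_{\{|x|<c\}}(x)\,\frac{dx}{|x|^{1+\alpha}}$ on $\mathbb{R}\setminus\{0\}$. Here $c>0$ is a fixed constant, $I$ is the indicator function, the stability index $\alpha\in(0,2)$ is known, and $$C_\alpha=\frac{\alpha\,\Gamma(\frac{1+\alpha}{2})}{2^{1-\alpha}\pi^{1/2}\Gamma(1-\frac{\alpha}{2})}.$$ The constant $\tilde C$ is $$\tilde C=C_\alpha\int_{\mathbb{R}\setminus\{0\}}\frac{y^2}{|y|^{1+\alpha}}I_{\{|y|<c\}}(y)\,dy\in(0,\infty).$$ The infinitesimal generator of the equation is $$\mathcal{L}f(x)=b(x)f'(x)+\tfrac12\sigma_1(x)^2f''(x)+C_\alpha\int_{\mathbb{R}\setminus\{0\}}[f(x+\sigma_2y)-f(x)]\,I_{\{|y|<c\}}(y)\frac{dy}{|y|^{1+\alpha}},$$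 with the integral understood using the symmetry of the measure, so that odd terms in $y$ contribute zero. Hence $\mathcal{L}x=b(x)$ and $\mathcal{L}x^2=2b(x)x+\sigma_1(x)^2+\tilde C\sigma_2^2$. The matrix $L$ is a finite-dimensional approximation of $\mathcal{L}$ in the basis $\Psi$: if $f(x)=B^\top\Psi(x)^\top$ then $(\mathcal{L}f)(x)\approx(LB)^\top\Psi(x)^\top$. The identification procedure treats this approximation as an equality for $f(x)=x$ and $f(x)=x^2$. The column vectors $B_1,B_2\in\mathbb{R}^{N_k+1}$ are defined by $x=B_1^\top\Psi(x)^\top$ and $x^2=B_2^\top\Psi(x)^\top$. Coefficient vectors of polynomials are padded with zeros to length $N_k+1$. For a column vector $v=[v_1,\ldots,v_n]^\top$, $(v)_+=[0,v_1,\ldots,v_{n-1}]^\top$ is the shift. The numbers $\tilde\eta_j$ are the coefficients of $x^j$ in $\sigma_1(x)^2$. The displayed system is the coefficient form, in the basis $\Psi$, of the identity $(\mathcal{L}f)(x)=2b(x)x+\sigma_1(x)^2+\tilde C\sigma_2^2$ for $f(x)=x^2$. *)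

theory Defs
  imports "HOL-Analysis.Analysis" "Jordan_Normal_Form.Matrix"
    "HOL-Computational_Algebra.Computational_Algebra"
begin

definition C_alpha :: "real \<Rightarrow> real" where
  "C_alpha \<alpha> =
     \<alpha> * Gamma ((1 + \<alpha>) / 2) / (2 powr (1 - \<alpha>) * pi powr (1 / 2) * Gamma (1 - \<alpha> / 2))"

definition jump_kernel :: "real \<Rightarrow> real \<Rightarrow> real \<Rightarrow> real" where
  "jump_kernel \<alpha> c y = indicator {y. \<bar>y\<bar> < c} y / \<bar>y\<bar> powr (1 + \<alpha>)"

definition C_tilde :: "real \<Rightarrow> real \<Rightarrow> real" where
  "C_tilde \<alpha> c =
     C_alpha \<alpha> * (LINT y:UNIV - {0}|lborel. y\<^sup>2 * jump_kernel \<alpha> c y)"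

(* For alpha >= 1 the jump integral does not converge absolutely at 0. It is taken as a
   principal value, i.e. as the limit over the symmetric regions |y| > eps, so that terms
   odd in y contribute zero. *)
definition generator ::
    "real \<Rightarrow> real \<Rightarrow> (real \<Rightarrow> real) \<Rightarrow> (real \<Rightarrow> real) \<Rightarrow> real \<Rightarrow> (real \<Rightarrow> real) \<Rightarrow> real \<Rightarrow> real" where
  "generator \<alpha> c b \<sigma>1 \<sigma>2 f x =
     b x * deriv f x + 1 / 2 * (\<sigma>1 x)\<^sup>2 * deriv (deriv f) x
     + C_alpha \<alpha> *
       Lim (at_right 0) (\<lambda>\<epsilon>.
         LINT y:{y. \<epsilon> < \<bar>y\<bar>}|lborel. (f (x + \<sigma>2 * y) - f x) * jump_kernel \<alpha> c y)"

definition poly_of :: "nat \<Rightarrow> (nat \<Rightarrow> real) \<Rightarrow> real poly" where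
  "poly_of p a = (\<Sum>j\<le>p. monom (a j) j)"

definition Psi :: "nat \<Rightarrow> real \<Rightarrow> real Matrix.vec" where
  "Psi N x = Matrix.vec (N + 1) (\<lambda>i. x ^ i)"

definition coeff_vec :: "nat \<Rightarrow> real poly \<Rightarrow> real Matrix.vec" where
  "coeff_vec N q = Matrix.vec (N + 1) (\<lambda>i. coeff q i)"

definition represents_on ::
    "nat \<Rightarrow> real Matrix.mat \<Rightarrow> ((real \<Rightarrow> real) \<Rightarrow> real \<Rightarrow> real) \<Rightarrow> (real \<Rightarrow> real) \<Rightarrow> bool" where
  "represents_on N L G f \<longleftrightarrow>
     (\<forall>B \<in> carrier_vec (N + 1). (\<forall>x. f x = scalar_prod B (Psi N x)) \<longrightarrow>
        (\<forall>x. G f x = scalar_prod (L *\<^sub>v B) (Psi N x)))"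

definition shift :: "real Matrix.vec \<Rightarrow> real Matrix.vec" where
  "shift v = Matrix.vec (dim_vec v) (\<lambda>i. if i = 0 then 0 else vec_index v (i - 1))"

definition eta_tilde :: "nat \<Rightarrow> (nat \<Rightarrow> real) \<Rightarrow> nat \<Rightarrow> real" where
  "eta_tilde p \<eta> j = (\<Sum>(k, l) \<in> {(k, l). k + l = j \<and> k \<le> p \<and> l \<le> p}. \<eta> k * \<eta> l)"

definition separation_system ::
    "nat \<Rightarrow> nat \<Rightarrow> real \<Rightarrow> (nat \<Rightarrow> real) \<Rightarrow> real \<Rightarrow> real Matrix.vec \<Rightarrow> bool" where
  "separation_system N p Ct \<eta> \<sigma>2 \<rho> \<longleftrightarrow>
     Matrix.vec (N + 1) (\<lambda>j. if j \<le> 2 * p then eta_tilde p \<eta> j else 0)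
     + Matrix.vec (N + 1) (\<lambda>j. if j = 0 then Ct * \<sigma>2\<^sup>2 else 0)
     = Matrix.vec (N + 1) (\<lambda>j. if j \<le> 2 * p then vec_index \<rho> j else 0)"

end

theory Submission imports Defs begin

text \<open>
  Together the two systems say that the polynomials \<open>\<sigma>1\<^sup>2 + C \<sigma>2\<^sup>2\<close> and \<open>\<sigma>1'\<^sup>2 + C \<sigma>2'\<^sup>2\<close> have the same
  coefficients, where \<open>C\<close> stands for \<open>C_tilde \<alpha> c\<close>. Hence
  \<open>(\<sigma>1 - \<sigma>1') (\<sigma>1 + \<sigma>1')\<close> is a constant. If that constant were nonzero, both factors would
  be units of the polynomial ring, that is, nonzero constants, and so their sum \<open>2 \<sigma>1\<close> would be
  constant too (\<open>square_diff_constant_imp_zero\<close>). So the constant vanishes, which means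
  \<open>\<sigma>1\<^sup>2 = \<sigma>1'\<^sup>2\<close> and \<open>C \<sigma>2\<^sup>2 = C \<sigma>2'\<^sup>2\<close>.

  Dividing by \<open>C\<close> requires \<open>C \<noteq> 0\<close>. That is a fact of analysis (\<open>C_tilde_pos\<close>): \<open>C\<close> is the positive
  normalising factor \<open>C_alpha \<alpha>\<close> times the integral of \<open>\<bar>y\<bar> powr (1 - \<alpha>)\<close> over \<open>\<bar>y\<bar> < c\<close>, which
  is positive, and converges at the origin because \<open>\<alpha> < 2\<close>. Convergence matters here, since a divergent
  integral would have the default value 0.
\<close>

lemma C_alpha_pos:
  assumes "0 < \<alpha>" "\<alpha> < 2"
  shows "0 < C_alpha \<alpha>"
  using assms by (simp add: C_alpha_def Gamma_real_pos)

lemma has_integral_abs_powr: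
  fixes a c :: real
  assumes "-1 < a" "0 \<le> c"
  shows "((\<lambda>y. \<bar>y\<bar> powr a) has_integral 2 * (c powr (a + 1) / (a + 1))) {-c..c}"
proof -
  let ?J = "c powr (a + 1) / (a + 1)"
  have "((\<lambda>y. y powr a) has_integral ?J) {0..c}"
    using assms by (rule has_integral_powr_from_0)
  then have pos: "((\<lambda>y. \<bar>y\<bar> powr a) has_integral ?J) {0..c}"
    by (rule has_integral_eq [rotated]) auto
  then have "((\<lambda>y. \<bar>- y\<bar> powr a) has_integral ?J) {-c..-0}"
    by (subst has_integral_reflect_real)
  then have neg: "((\<lambda>y. \<bar>y\<bar> powr a) has_integral ?J) {-c..0}"
    by simp
  show ?thesis
    using has_integral_combine [OF _ _ neg pos] assms by simp
qed

text \<open>The jump kernel times \<open>y\<^sup>2\<close> is a power of \<open>\<bar>y\<bar>\<close> whose exponent \<open>1 - \<alpha>\<close> exceeds \<open>-1\<close>, so the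
  elementary primitive gives the integral. As the integrand is nonnegative, the gauge integral
  computed above is also the Lebesgue integral.\<close>

lemma second_moment_jump_kernel:
  assumes "\<alpha> < 2" "0 < c"
  shows "(LINT y:UNIV - {0}|lborel. y\<^sup>2 * jump_kernel \<alpha> c y) = 2 * (c powr (2 - \<alpha>) / (2 - \<alpha>))"
proof -
  define g where "g y = indicator {-c<..<c} y * \<bar>y\<bar> powr (1 - \<alpha>)" for y :: real
  have g_eq: "indicator (UNIV - {0}) y *\<^sub>R (y\<^sup>2 * jump_kernel \<alpha> c y) = g y" for y
  proof (cases "y = 0")
    case False
    have "y\<^sup>2 = \<bar>y\<bar> powr 2"
      using False by simp
    then have "y\<^sup>2 / \<bar>y\<bar> powr (1 + \<alpha>) = \<bar>y\<bar> powr (2 - (1 + \<alpha>))"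
      by (simp only: powr_diff)
    then have "y\<^sup>2 / \<bar>y\<bar> powr (1 + \<alpha>) = \<bar>y\<bar> powr (1 - \<alpha>)"
      by simp
    then show ?thesis
      using False by (auto simp: g_def jump_kernel_def indicator_def)
  qed (simp add: g_def)
  have "((\<lambda>y. \<bar>y\<bar> powr (1 - \<alpha>)) has_integral 2 * (c powr (2 - \<alpha>) / (2 - \<alpha>))) {-c<..<c}"
    using has_integral_abs_powr [of "1 - \<alpha>" c] assms
    by (simp add: has_integral_Icc_iff_Ioo)
  moreover have g_alt: "g = (\<lambda>y. if y \<in> {-c<..<c} then \<bar>y\<bar> powr (1 - \<alpha>) else 0)"
    by (auto simp: g_def)
  ultimately have "(g has_integral 2 * (c powr (2 - \<alpha>) / (2 - \<alpha>))) UNIV"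
    by (simp only: g_alt has_integral_restrict_UNIV)
  then have "(\<integral>\<^sup>+ y. g y \<partial>lborel) = ennreal (2 * (c powr (2 - \<alpha>) / (2 - \<alpha>)))"
    by (rule nn_integral_has_integral_lborel [rotated 2]) (auto simp: g_def [abs_def])
  then have "(LINT y|lborel. g y) = 2 * (c powr (2 - \<alpha>) / (2 - \<alpha>))"
    using assms by (subst integral_eq_nn_integral) (auto simp: g_def [abs_def])
  then show ?thesis
    by (simp only: set_lebesgue_integral_def g_eq)
qed

lemma C_tilde_pos:
  assumes "0 < \<alpha>" "\<alpha> < 2" "0 < c"
  shows "0 < C_tilde \<alpha> c"
  using assms by (simp add: C_tilde_def second_moment_jump_kernel C_alpha_pos)

text \<open>Factors of a nonzero constant polynomial over a domain are constant. The two factors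
  \<open>p - q\<close> and \<open>p + q\<close> sum to \<open>2 p\<close>, and in characteristic 0 that has the degree of \<open>p\<close>.\<close>

lemma square_diff_constant_imp_zero:
  fixes p q :: "'a :: {idom, ring_char_0} poly"
  assumes eq: "p\<^sup>2 - q\<^sup>2 = [:k:]" and "degree p \<noteq> 0"
  shows "k = 0"
proof (rule ccontr)
  assume "k \<noteq> 0"
  have prod: "(p - q) * (p + q) = [:k:]"
    using eq by (simp add: power2_eq_square algebra_simps)
  with \<open>k \<noteq> 0\<close> have "p - q \<noteq> 0" "p + q \<noteq> 0"
    by auto
  then have "degree (p - q) + degree (p + q) = 0"
    by (metis prod degree_mult_eq degree_pCons_0)
  then have "degree ((p - q) + (p + q)) = 0"
    by (metis add_is_0 degree_add_le le_zero_eq)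
  also have "(p - q) + (p + q) = Polynomial.smult 2 p"
    by (rule poly_eqI) (simp only: coeff_add coeff_diff coeff_smult mult_2, simp)
  finally show False
    using \<open>degree p \<noteq> 0\<close> by simp
qed

lemma coeff_poly_of_square: "coeff ((poly_of p \<eta>)\<^sup>2) j = eta_tilde p \<eta> j"
proof -
  have "(poly_of p \<eta>)\<^sup>2 = (\<Sum>(k, l) \<in> {..p} \<times> {..p}. monom (\<eta> k * \<eta> l) (k + l))"
    by (simp add: poly_of_def power2_eq_square sum_product mult_monom sum.cartesian_product)
  then have "coeff ((poly_of p \<eta>)\<^sup>2) j =
      (\<Sum>z \<in> {..p} \<times> {..p}. if fst z + snd z = j then \<eta> (fst z) * \<eta> (snd z) else 0)"
    by (simp add: coeff_sum split_def)
  also have "\<dots> = (\<Sum>z \<in> {z \<in> {..p} \<times> {..p}. fst z + snd z = j}. \<eta> (fst z) * \<eta> (snd z))"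
    by (simp flip: sum.inter_filter)
  also have "{z \<in> {..p} \<times> {..p}. fst z + snd z = j} = {(k, l). k + l = j \<and> k \<le> p \<and> l \<le> p}"
    by auto
  finally show ?thesis
    by (simp add: eta_tilde_def split_def)
qed

text \<open>The vectors of the system record only the rows up to \<open>N\<close>, and the right-hand side is cut off
  after row \<open>2 * p\<close>. No coefficient escapes: \<open>2 * p \<le> N\<close>, and \<open>\<sigma>1\<^sup>2\<close> has none beyond \<open>2 * p\<close>.\<close>

lemma separation_system_imp_coeff:
  assumes sys: "separation_system N p C \<eta> s \<rho>" and "2 * p \<le> N"
  shows "coeff ((poly_of p \<eta>)\<^sup>2 + [:C * s\<^sup>2:]) j = (if j \<le> 2 * p then vec_index \<rho> j else 0)"
proof (cases "j \<le> 2 * p")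
  case True
  with \<open>2 * p \<le> N\<close> have "j < N + 1"
    by simp
  with True arg_cong [OF sys [unfolded separation_system_def], of "\<lambda>v. vec_index v j"]
  show ?thesis
    by (cases j) (simp_all add: coeff_poly_of_square)
next
  case False
  then have "{(k, l). k + l = j \<and> k \<le> p \<and> l \<le> p} = {}"
    by auto
  then have "eta_tilde p \<eta> j = 0"
    by (simp only: eta_tilde_def sum.empty)
  with False show ?thesis
    by (cases j) (simp_all add: coeff_poly_of_square)
qed

theorem proposition3p1:
  fixes \<alpha> c \<sigma>2 \<sigma>2' :: real and p1 p2 N :: nat
    and \<beta> \<eta> \<eta>' :: "nat \<Rightarrow> real"
    and b \<sigma>1 \<sigma>1' :: "real poly"
    and L :: "real Matrix.mat" and B1 B2 \<xi> \<rho> :: "real Matrix.vec"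
  assumes "0 < \<alpha>" "\<alpha> < 2" "0 < c"
    and b_def: "b = poly_of p1 \<beta>"
    and \<sigma>1_def: "\<sigma>1 = poly_of p2 \<eta>"
    and \<sigma>1'_def: "\<sigma>1' = poly_of p2 \<eta>'"
    and "0 \<le> \<sigma>2" "0 \<le> \<sigma>2'"
    and "max 2 (max (p1 + 1) (2 * p2)) \<le> N"
    and "L \<in> carrier_mat (N + 1) (N + 1)"
    and "B1 \<in> carrier_vec (N + 1)" "\<And>x. x = scalar_prod B1 (Psi N x)"
    and "B2 \<in> carrier_vec (N + 1)" "\<And>x. x\<^sup>2 = scalar_prod B2 (Psi N x)"
    and "represents_on N L (generator \<alpha> c (poly b) (poly \<sigma>1) \<sigma>2) (\<lambda>x. x)"
    and "represents_on N L (generator \<alpha> c (poly b) (poly \<sigma>1) \<sigma>2) (\<lambda>x. x\<^sup>2)"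
    and \<xi>_def: "\<xi> = L *\<^sub>v B1" and "\<xi> = coeff_vec N b"
    and \<rho>_def: "\<rho> = L *\<^sub>v B2 - 2 \<cdot>\<^sub>v shift \<xi>"
    and "\<And>i. 2 * p2 < i \<Longrightarrow> i \<le> N \<Longrightarrow> vec_index \<rho> i = 0"
    and "separation_system N p2 (C_tilde \<alpha> c) \<eta> \<sigma>2 \<rho>"
    and "separation_system N p2 (C_tilde \<alpha> c) \<eta>' \<sigma>2' \<rho>"
    and "\<not> constant (poly \<sigma>1)" and "\<not> constant (poly \<sigma>1')"
  shows "\<sigma>1\<^sup>2 = \<sigma>1'\<^sup>2 \<and> \<sigma>2 = \<sigma>2'"
proof -
  let ?C = "C_tilde \<alpha> c"
  have "2 * p2 \<le> N"
    using \<open>max 2 (max (p1 + 1) (2 * p2)) \<le> N\<close> by simp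
  then have "\<sigma>1\<^sup>2 + [:?C * \<sigma>2\<^sup>2:] = \<sigma>1'\<^sup>2 + [:?C * \<sigma>2'\<^sup>2:]"
    using separation_system_imp_coeff [OF \<open>separation_system N p2 ?C \<eta> \<sigma>2 \<rho>\<close>]
      separation_system_imp_coeff [OF \<open>separation_system N p2 ?C \<eta>' \<sigma>2' \<rho>\<close>]
    unfolding \<sigma>1_def \<sigma>1'_def by (simp only: poly_eq_iff) simp
  moreover have "u - v = y - x" if "u + x = v + y" for u v x y :: "real poly"
    using that by (simp add: algebra_simps)
  ultimately have "\<sigma>1\<^sup>2 - \<sigma>1'\<^sup>2 = [:?C * \<sigma>2'\<^sup>2:] - [:?C * \<sigma>2\<^sup>2:]"
    by blast
  moreover define k where "k = ?C * \<sigma>2'\<^sup>2 - ?C * \<sigma>2\<^sup>2"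
  ultimately have diff: "\<sigma>1\<^sup>2 - \<sigma>1'\<^sup>2 = [:k:]"
    by simp
  have "degree \<sigma>1 \<noteq> 0"
    using \<open>\<not> constant (poly \<sigma>1)\<close> by (simp add: constant_degree)
  with diff have "k = 0"
    by (rule square_diff_constant_imp_zero)
  have "\<sigma>2\<^sup>2 = \<sigma>2'\<^sup>2"
    using \<open>k = 0\<close> C_tilde_pos [OF \<open>0 < \<alpha>\<close> \<open>\<alpha> < 2\<close> \<open>0 < c\<close>] by (simp add: k_def)
  then have "\<sigma>2 = \<sigma>2'"
    using \<open>0 \<le> \<sigma>2\<close> \<open>0 \<le> \<sigma>2'\<close> by simp
  with diff \<open>k = 0\<close> show ?thesis
    by simp
qed

end
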